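(* The lattice $\mathbf{Peq}$ of punctual degrees is distributive.
   Context: A punctual equivalence relation is a primitive recursive equivalence relation with domain $\omega$ having infinitely many equivalence classes. For equivalence relations $R,S$ on $\omega$, $R\leq_{pr} S$ means that there is a primitive recursive function $f:\omega\to\omega$ such that for all $x,y\in\omega$, $x\mathrel{R}y \Leftrightarrow f(x)\mathrel{S}f(y)$. Write $R\equiv_{pr}S$ if $R\leq_{pr}S$ and $S\leq_{pr}R$. $\mathbf{Peq}$ is the partial order of $\equiv_{pr}$-classes (punctual degrees) of punctual equivalence relations, ordered by the order induced by $\leq_{pr}$. It is a lattice: any two elements have a least upper bound and a greatest lower bound. *)

theory Defs
  imports "HOL-Algebra.Lattice"
begin

text \<open>
  \<open>prim_rec n f\<close>: the \<open>n\<close>-ary function \<open>f\<close>, applied to argument lists of length \<open>n\<close>, is primitive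
  recursive.  The values of \<open>f\<close> on lists of any other length carry no meaning.
\<close>

inductive prim_rec :: "nat \<Rightarrow> (nat list \<Rightarrow> nat) \<Rightarrow> bool" where
  zero: "prim_rec n (\<lambda>_. 0)"
| succ: "prim_rec 1 (\<lambda>xs. Suc (xs ! 0))"
| proj: "i < n \<Longrightarrow> prim_rec n (\<lambda>xs. xs ! i)"
| comp: "prim_rec (length gs) f \<Longrightarrow> \<forall>g\<in>set gs. prim_rec n g \<Longrightarrow>
    prim_rec n (\<lambda>xs. f (map (\<lambda>g. g xs) gs))"
| prec: "prim_rec n f \<Longrightarrow> prim_rec (Suc (Suc n)) g \<Longrightarrow>
    prim_rec (Suc n) (\<lambda>xs. rec_nat (f (tl xs)) (\<lambda>k r. g (k # r # tl xs)) (hd xs))"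

definition prim_rec_fun :: "(nat \<Rightarrow> nat) \<Rightarrow> bool" where
  "prim_rec_fun f \<longleftrightarrow> (\<exists>F. prim_rec 1 F \<and> (\<forall>x. f x = F [x]))"

definition prim_rec_rel :: "nat rel \<Rightarrow> bool" where
  "prim_rec_rel R \<longleftrightarrow> (\<exists>F. prim_rec 2 F \<and> (\<forall>x y. F [x, y] = (if (x, y) \<in> R then 1 else 0)))"

definition punctual_eqrel :: "nat rel \<Rightarrow> bool" where
  "punctual_eqrel R \<longleftrightarrow> equiv UNIV R \<and> prim_rec_rel R \<and> infinite (UNIV // R)"

definition pr_le :: "nat rel \<Rightarrow> nat rel \<Rightarrow> bool" (infix \<open>\<le>\<^sub>p\<^sub>r\<close> 50) where
  "R \<le>\<^sub>p\<^sub>r S \<longleftrightarrow> (\<exists>f. prim_rec_fun f \<and> (\<forall>x y. (x, y) \<in> R \<longleftrightarrow> (f x, f y) \<in> S))"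

definition pr_equiv :: "nat rel \<Rightarrow> nat rel \<Rightarrow> bool" (infix \<open>\<equiv>\<^sub>p\<^sub>r\<close> 50) where
  "R \<equiv>\<^sub>p\<^sub>r S \<longleftrightarrow> R \<le>\<^sub>p\<^sub>r S \<and> S \<le>\<^sub>p\<^sub>r R"

definition punctual_equiv :: "nat rel rel" where
  "punctual_equiv = {(R, S). punctual_eqrel R \<and> punctual_eqrel S \<and> R \<equiv>\<^sub>p\<^sub>r S}"

definition Peq :: "nat rel set gorder" where
  "Peq = \<lparr>carrier = {R. punctual_eqrel R} // punctual_equiv, eq = (=),
          le = (\<lambda>a b. \<exists>R\<in>a. \<exists>S\<in>b. R \<le>\<^sub>p\<^sub>r S)\<rparr>"

locale distributive_lattice = lattice +
  assumes meet_join_distrib: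
    "\<lbrakk>x \<in> carrier L; y \<in> carrier L; z \<in> carrier L\<rbrakk> \<Longrightarrow>
      x \<sqinter> (y \<squnion> z) = (x \<sqinter> y) \<squnion> (x \<sqinter> z)"

lemma pr_le_refl: "R \<le>\<^sub>p\<^sub>r R"
  unfolding pr_le_def prim_rec_fun_def
  by (rule exI[of _ "\<lambda>x. x"]) (auto intro!: exI[of _ "\<lambda>xs. xs ! 0"] prim_rec.proj)

lemma prim_rec_fun_comp:
  assumes "prim_rec_fun f" "prim_rec_fun g"
  shows "prim_rec_fun (\<lambda>x. g (f x))"
proof -
  obtain F G where F: "prim_rec 1 F" "\<And>x. f x = F [x]" and G: "prim_rec 1 G" "\<And>x. g x = G [x]"
    using assms unfolding prim_rec_fun_def by blast
  have "prim_rec 1 (\<lambda>xs. G (map (\<lambda>g. g xs) [F]))"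
    using F(1) G(1) by (intro prim_rec.comp) auto
  then show ?thesis
    unfolding prim_rec_fun_def using F(2) G(2) by auto
qed

lemma pr_le_trans: "R \<le>\<^sub>p\<^sub>r S \<Longrightarrow> S \<le>\<^sub>p\<^sub>r T \<Longrightarrow> R \<le>\<^sub>p\<^sub>r T"
  unfolding pr_le_def
  by clarify (rule exI, rule conjI, rule prim_rec_fun_comp, assumption+, simp)

lemma equiv_punctual_equiv: "equiv {R. punctual_eqrel R} punctual_equiv"
  unfolding punctual_equiv_def pr_equiv_def
  by (intro equivI refl_onI symI transI) (auto intro: pr_le_refl pr_le_trans)

text \<open>The order of \<open>Peq\<close> does not depend on the choice of representatives:\<close>

lemma Peq_le_iff:
  assumes "punctual_eqrel R" "punctual_eqrel S"
  shows "le Peq (punctual_equiv `` {R}) (punctual_equiv `` {S}) \<longleftrightarrow> R \<le>\<^sub>p\<^sub>r S"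
  using assms unfolding Peq_def punctual_equiv_def pr_equiv_def
  by (auto intro: pr_le_refl pr_le_trans)

end

theory Submission
  imports Defs
begin

text \<open>
  The degree of a punctual equivalence relation \<open>R\<close> is determined by how fast new classes show up.
  Let \<open>c\<^sub>R x\<close> be the number of positive \<open>y \<le> x\<close> that are equivalent to nothing smaller, so that
  \<open>c\<^sub>R x + 1\<close> classes meet \<open>{0..x}\<close>.  A reduction of \<open>R\<close> to \<open>S\<close> sends pairwise inequivalent numbers
  up to \<open>x\<close> to pairwise inequivalent ones up to some primitive recursive bound \<open>h x\<close>, hence
  \<open>c\<^sub>R \<le> c\<^sub>S \<circ> h\<close>.  Conversely, given such an \<open>h\<close>, a number lying in the \<open>i\<close>-th class of \<open>R\<close> can be sent
  to the first element of the \<open>i\<close>-th class of \<open>S\<close>, because a search up to \<open>h x\<close> will find it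
  (\<open>kernel_le_iff\<close>).

  The functions \<open>c\<^sub>R\<close> are exactly the primitive recursive staircases: they start at 0, climb
  by 0 or 1, and are unbounded.  Moreover \<open>R\<close> has the same degree as the kernel of \<open>c\<^sub>R\<close>
  (\<open>pr_equiv_kernel_class_count\<close>).  Hence the order of punctual degrees is
  the order of staircases under domination \<open>c \<le> d \<circ> h\<close>.  Staircases are closed under pointwise
  maximum and minimum.  Since they are monotone, two bounds \<open>h\<close> and \<open>h'\<close> can be replaced by
  their pointwise maximum, and this makes the pointwise maximum a join and the pointwise minimum
  a meet.  Distributivity is therefore inherited from the linear order of the natural numbers.
\<close>

section \<open>Closure properties of primitive recursion\<close>

text \<open>
  Primitive recursiveness up to the values on lists of the wrong length.  In contrast to
  \<open>prim_rec\<close>, this is stable under rewriting a function to one with the same meaningful values.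
\<close>

definition pr_ary :: "nat \<Rightarrow> (nat list \<Rightarrow> nat) \<Rightarrow> bool" where
  "pr_ary n f \<longleftrightarrow> (\<exists>F. prim_rec n F \<and> (\<forall>xs. length xs = n \<longrightarrow> f xs = F xs))"

lemma pr_ary_cong:
  assumes "pr_ary n f" "\<And>xs. length xs = n \<Longrightarrow> g xs = f xs"
  shows "pr_ary n g"
  using assms unfolding pr_ary_def by fastforce

lemma pr_ary_prim_rec: "prim_rec n f \<Longrightarrow> pr_ary n f"
  unfolding pr_ary_def by blast

lemma pr_ary_subst:
  assumes f: "pr_ary (length gs) f" and gs: "\<And>g. g \<in> set gs \<Longrightarrow> pr_ary n g"
  shows "pr_ary n (\<lambda>xs. f (map (\<lambda>g. g xs) gs))"
proof -
  obtain F where F: "prim_rec (length gs) F" "\<And>xs. length xs = length gs \<Longrightarrow> f xs = F xs"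
    using f unfolding pr_ary_def by blast
  have "\<forall>g\<in>set gs. \<exists>G. prim_rec n G \<and> (\<forall>xs. length xs = n \<longrightarrow> g xs = G xs)"
    using gs unfolding pr_ary_def by blast
  then obtain G where
    G: "\<And>g. g \<in> set gs \<Longrightarrow> prim_rec n (G g)"
       "\<And>g xs. g \<in> set gs \<Longrightarrow> length xs = n \<Longrightarrow> g xs = G g xs"
    by (auto dest!: bchoice)
  have "prim_rec n (\<lambda>xs. F (map (\<lambda>g. g xs) (map G gs)))"
    by (rule prim_rec.comp) (use F G in auto)
  then show ?thesis
  proof (rule pr_ary_cong[OF pr_ary_prim_rec])
    fix xs :: "nat list" assume "length xs = n"
    then have "map (\<lambda>g. g xs) gs = map (\<lambda>g. g xs) (map G gs)"
      using G(2) by simp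
    then show "f (map (\<lambda>g. g xs) gs) = F (map (\<lambda>g. g xs) (map G gs))"
      by (simp only: F(2) length_map)
  qed
qed

lemma pr_ary_nth: "i < n \<Longrightarrow> pr_ary n (\<lambda>xs. xs ! i)"
  by (rule pr_ary_prim_rec[OF prim_rec.proj])

lemma prim_rec_fun_iff: "prim_rec_fun f \<longleftrightarrow> pr_ary 1 (\<lambda>xs. f (xs ! 0))"
proof
  show "prim_rec_fun f \<Longrightarrow> pr_ary 1 (\<lambda>xs. f (xs ! 0))"
    unfolding prim_rec_fun_def pr_ary_def by (auto simp: length_Suc_conv)
next
  assume "pr_ary 1 (\<lambda>xs. f (xs ! 0))"
  then obtain F where "prim_rec 1 F" "\<And>xs. length xs = 1 \<Longrightarrow> f (xs ! 0) = F xs"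
    unfolding pr_ary_def by blast
  then show "prim_rec_fun f"
    unfolding prim_rec_fun_def by (metis One_nat_def length_Cons list.size(3) nth_Cons_0)
qed

lemma prim_rec_fun_id: "prim_rec_fun (\<lambda>x. x)"
  unfolding prim_rec_fun_iff by (simp add: pr_ary_nth)

lemma pr_ary_comp1:
  assumes "prim_rec_fun f" "pr_ary n g"
  shows "pr_ary n (\<lambda>xs. f (g xs))"
  using pr_ary_subst[of "[g]" "\<lambda>xs. f (xs ! 0)" n] assms by (simp add: prim_rec_fun_iff)

lemma pr_ary_comp2:
  assumes "pr_ary 2 (\<lambda>xs. f (xs ! 0) (xs ! 1))" "pr_ary n g" "pr_ary n h"
  shows "pr_ary n (\<lambda>xs. f (g xs) (h xs))"
  using pr_ary_subst[of "[g, h]" "\<lambda>xs. f (xs ! 0) (xs ! 1)" n] assms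
  by (auto simp: numeral_2_eq_2)

lemma prim_rec_fun_Suc: "prim_rec_fun Suc"
  unfolding prim_rec_fun_iff by (rule pr_ary_prim_rec[OF prim_rec.succ])

lemmas pr_ary_Suc = pr_ary_comp1[OF prim_rec_fun_Suc]

lemma pr_ary_const: "pr_ary n (\<lambda>_. k)"
  by (induction k) (auto intro: pr_ary_prim_rec[OF prim_rec.zero] pr_ary_Suc)

text \<open>Inside a recursion step the parameters follow the counter and the previous value.\<close>

lemma pr_ary_drop2:
  assumes "pr_ary n f"
  shows "pr_ary (Suc (Suc n)) (\<lambda>ys. f (drop 2 ys))"
proof -
  let ?gs = "map (\<lambda>i ys. ys ! Suc (Suc i)) [0..<n] :: (nat list \<Rightarrow> nat) list"
  have "pr_ary (Suc (Suc n)) (\<lambda>ys. f (map (\<lambda>g. g ys) ?gs))"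
    by (rule pr_ary_subst) (use assms in \<open>auto intro: pr_ary_nth\<close>)
  then show ?thesis
    by (rule pr_ary_cong) (auto intro!: arg_cong[of _ _ f] nth_equalityI)
qed

lemma pr_ary_rec:
  assumes a: "pr_ary n a" and m: "pr_ary n m"
    and s: "pr_ary (Suc (Suc n)) (\<lambda>ys. s (ys ! 0) (ys ! 1) (drop 2 ys))"
  shows "pr_ary n (\<lambda>xs. rec_nat (a xs) (\<lambda>k r. s k r xs) (m xs))"
proof -
  obtain A where A: "prim_rec n A" "\<And>xs. length xs = n \<Longrightarrow> a xs = A xs"
    using a unfolding pr_ary_def by blast
  obtain G where G: "prim_rec (Suc (Suc n)) G"
    "\<And>ys. length ys = Suc (Suc n) \<Longrightarrow> s (ys ! 0) (ys ! 1) (drop 2 ys) = G ys"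
    using s unfolding pr_ary_def by blast
  have G': "s k r xs = G (k # r # xs)" if "length xs = n" for k r xs
    using G(2)[of "k # r # xs"] that by simp
  let ?gs = "m # map (\<lambda>i xs. xs ! i) [0..<n]"
  let ?H = "\<lambda>ys. rec_nat (A (tl ys)) (\<lambda>k r. G (k # r # tl ys)) (hd ys)"
  have "pr_ary n (\<lambda>xs. ?H (map (\<lambda>g. g xs) ?gs))"
  proof (rule pr_ary_subst)
    show "pr_ary (length ?gs) ?H"
      using prim_rec.prec[OF A(1) G(1)] by (simp add: pr_ary_prim_rec)
  qed (use m in \<open>auto intro: pr_ary_nth\<close>)
  then show ?thesis
  proof (rule pr_ary_cong)
    fix xs :: "nat list" assume len: "length xs = n"
    then have "map (\<lambda>g. g xs) ?gs = m xs # xs"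
      by (auto intro: nth_equalityI)
    then show "rec_nat (a xs) (\<lambda>k r. s k r xs) (m xs) = ?H (map (\<lambda>g. g xs) ?gs)"
      using A(2)[OF len] G'[OF len] by simp
  qed
qed

lemma pr_ary_add:
  assumes "pr_ary n f" "pr_ary n g"
  shows "pr_ary n (\<lambda>xs. f xs + g xs)"
proof -
  have "x + y = rec_nat x (\<lambda>_. Suc) y" for x y by (induction y) auto
  then show ?thesis
    using pr_ary_rec[OF assms, of "\<lambda>_ r _. Suc r"] by (simp add: pr_ary_Suc pr_ary_nth)
qed

lemma pr_ary_diff:
  assumes "pr_ary n f" "pr_ary n g"
  shows "pr_ary n (\<lambda>xs. f xs - g xs)"
proof -
  have pred: "pr_ary k (\<lambda>xs. h xs - 1)" if "pr_ary k h" for k h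
  proof -
    have "x - 1 = rec_nat 0 (\<lambda>k _. k) x" for x :: nat by (cases x) auto
    then show ?thesis
      using pr_ary_rec[OF pr_ary_const that, of "\<lambda>k _ _. k"] by (simp add: pr_ary_nth)
  qed
  have eq: "x - y = rec_nat x (\<lambda>_ r. r - 1) y" for x y :: nat by (induction y) auto
  show ?thesis
    by (rule pr_ary_cong[OF pr_ary_rec[OF assms, of "\<lambda>_ r _. r - 1"] eq])
       (intro pred pr_ary_nth, simp)
qed

lemma pr_ary_if_eq:
  assumes p: "pr_ary n p" "pr_ary n q" and f: "pr_ary n f" and g: "pr_ary n g"
  shows "pr_ary n (\<lambda>xs. if p xs = q xs then f xs else g xs)"
proof -
  \<comment> \<open>As subtraction is truncated, this is the distance of \<open>p xs\<close> and \<open>q xs\<close>.\<close>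
  let ?d = "\<lambda>xs. (p xs - q xs) + (q xs - p xs)"
  have "pr_ary n ?d"
    by (intro pr_ary_add pr_ary_diff p)
  \<comment> \<open>A recursion that ignores its history distinguishes 0 from the positive numbers.\<close>
  then have "pr_ary n (\<lambda>xs. rec_nat (f xs) (\<lambda>_ _. g xs) (?d xs))"
    using pr_ary_rec[OF f _ pr_ary_drop2[OF g]] by blast
  moreover have "(if p xs = q xs then f xs else g xs) = rec_nat (f xs) (\<lambda>_ _. g xs) (?d xs)" for xs
    by (cases "?d xs") auto
  ultimately show ?thesis
    by (simp only:)
qed

lemma prim_rec_fun_max:
  assumes "prim_rec_fun f" "prim_rec_fun g"
  shows "prim_rec_fun (\<lambda>x. max (f x) (g x))"
proof -
  have "max a b = a + (b - a)" for a b :: nat by simp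
  then show ?thesis
    using assms unfolding prim_rec_fun_iff by (simp only:) (intro pr_ary_add pr_ary_diff)
qed

lemma prim_rec_fun_min:
  assumes "prim_rec_fun f" "prim_rec_fun g"
  shows "prim_rec_fun (\<lambda>x. min (f x) (g x))"
proof -
  have "min a b = a - (a - b)" for a b :: nat by simp
  then show ?thesis
    using assms unfolding prim_rec_fun_iff by (simp only:) (intro pr_ary_diff)
qed

lemma prim_rec_fun_sum:
  assumes "prim_rec_fun f"
  shows "prim_rec_fun (\<lambda>x. \<Sum>i<x. f i)"
proof -
  have "(\<Sum>i<x. f i) = rec_nat 0 (\<lambda>k r. r + f k) x" for x by (induction x) auto
  moreover have "pr_ary 1 (\<lambda>xs. rec_nat 0 (\<lambda>k r. r + f k) (xs ! 0))"
    by (rule pr_ary_rec[where s = "\<lambda>k r _. r + f k"])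
       (auto intro!: pr_ary_const pr_ary_nth pr_ary_add pr_ary_comp1[OF assms])
  ultimately show ?thesis
    unfolding prim_rec_fun_iff by simp
qed

text \<open>
  Bounded search: \<open>first P m\<close> is the least witness of \<open>P\<close> below \<open>m\<close>, and \<open>m\<close> itself if there is
  none.  Returning the bound upon failure lets the search proceed without remembering whether
  it has succeeded.
\<close>

primrec first :: "(nat \<Rightarrow> bool) \<Rightarrow> nat \<Rightarrow> nat" where
  "first P 0 = 0"
| "first P (Suc k) = (if P (first P k) then first P k else Suc k)"

lemma first_invariant:
  "first P m \<le> m \<and> (\<forall>i<first P m. \<not> P i) \<and> (P (first P m) \<or> first P m = m)"
  by (induction m) (auto simp: less_Suc_eq)

lemma first_satisfies:
  assumes "z \<le> m" "P z"
  shows "P (first P m)"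
  using first_invariant[of P m] assms by (metis order_le_less)

lemma first_le: "P z \<Longrightarrow> first P m \<le> z"
  using first_invariant[of P m] not_less by blast

lemma prim_rec_fun_first:
  assumes p: "pr_ary 2 (\<lambda>xs. if P (xs ! 0) (xs ! 1) then 1 else 0)" and m: "prim_rec_fun m"
  shows "prim_rec_fun (\<lambda>x. first (\<lambda>z. P z x) (m x))"
proof -
  let ?s = "\<lambda>k r xs. if (if P r (xs ! 0) then 1 else 0) = (0::nat) then Suc k else r"
  have "first (\<lambda>z. P z x) n = rec_nat 0 (\<lambda>k r. ?s k r [x]) n" for x n
    by (induction n) auto
  moreover have "pr_ary 1 (\<lambda>xs. rec_nat 0 (\<lambda>k r. ?s k r xs) (m (xs ! 0)))"
  proof (rule pr_ary_rec[where s = ?s])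
    have "pr_ary (Suc (Suc 1)) (\<lambda>ys. if P (ys ! 1) (ys ! 2) then 1 else 0)"
      by (rule pr_ary_comp2[of "\<lambda>a b. if P a b then 1 else 0", OF p]) (simp_all add: pr_ary_nth)
    then have "pr_ary (Suc (Suc 1))
        (\<lambda>ys. if (if P (ys ! 1) (ys ! 2) then 1 else 0) = (0::nat) then Suc (ys ! 0) else ys ! 1)"
      by (intro pr_ary_if_eq pr_ary_const pr_ary_Suc pr_ary_nth) simp_all
    then show "pr_ary (Suc (Suc 1)) (\<lambda>ys. ?s (ys ! 0) (ys ! 1) (drop 2 ys))"
      by (rule pr_ary_cong) auto
  qed (use m in \<open>auto simp: pr_ary_const prim_rec_fun_iff\<close>)
  ultimately show ?thesis
    unfolding prim_rec_fun_iff by simp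
qed

section \<open>Staircases and their kernels\<close>

definition staircase :: "(nat \<Rightarrow> nat) \<Rightarrow> bool" where
  "staircase c \<longleftrightarrow> prim_rec_fun c \<and> c 0 = 0 \<and> (\<forall>x. c x \<le> c (Suc x) \<and> c (Suc x) \<le> Suc (c x)) \<and>
     (\<forall>n. \<exists>x. n \<le> c x)"

definition kernel :: "(nat \<Rightarrow> nat) \<Rightarrow> nat rel" where
  "kernel c = {(x, y). c x = c y}"

definition dominated :: "(nat \<Rightarrow> nat) \<Rightarrow> (nat \<Rightarrow> nat) \<Rightarrow> bool" where
  "dominated c d \<longleftrightarrow> (\<exists>h. prim_rec_fun h \<and> (\<forall>x. c x \<le> d (h x)))"

lemma staircase_mono:
  assumes "staircase c" "x \<le> y"
  shows "c x \<le> c y"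
  using assms lift_Suc_mono_le[of c x y] unfolding staircase_def by blast

text \<open>A discrete intermediate value theorem: a climb by steps of at most 1 skips nothing.\<close>

lemma staircase_attains:
  assumes "staircase c" "n \<le> c x"
  shows "\<exists>z\<le>x. c z = n"
  using assms(2)
proof (induction x)
  case 0
  then show ?case using assms(1) unfolding staircase_def by auto
next
  case (Suc x)
  have "c (Suc x) \<le> Suc (c x)" using assms(1) unfolding staircase_def by blast
  then show ?case using Suc by (metis le_Suc_eq le_antisym le_trans order_refl)
qed

lemma pr_ary_eq_test:
  assumes "prim_rec_fun c" "prim_rec_fun d"
  shows "pr_ary 2 (\<lambda>xs. if c (xs ! 0) = d (xs ! 1) then 1 else 0)"
  by (intro pr_ary_if_eq pr_ary_comp1[OF assms(1)] pr_ary_comp1[OF assms(2)] pr_ary_const pr_ary_nth) auto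

lemma prim_rec_rel_iff:
  "prim_rec_rel R \<longleftrightarrow> pr_ary 2 (\<lambda>xs. if (xs ! 0, xs ! 1) \<in> R then 1 else 0)"
proof
  assume "prim_rec_rel R"
  then obtain F where "prim_rec 2 F" "\<And>x y. F [x, y] = (if (x, y) \<in> R then 1 else 0)"
    unfolding prim_rec_rel_def by blast
  then show "pr_ary 2 (\<lambda>xs. if (xs ! 0, xs ! 1) \<in> R then 1 else 0)"
    unfolding pr_ary_def by (auto simp: length_Suc_conv numeral_2_eq_2 intro!: exI[of _ F])
next
  assume "pr_ary 2 (\<lambda>xs. if (xs ! 0, xs ! 1) \<in> R then 1 else 0)"
  then obtain F where F: "prim_rec 2 F"
    "\<And>xs. length xs = 2 \<Longrightarrow> (if (xs ! 0, xs ! 1) \<in> R then 1 else 0) = F xs"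
    unfolding pr_ary_def by blast
  then have "F [x, y] = (if (x, y) \<in> R then 1 else 0)" for x y
    using F(2)[of "[x, y]"] by simp
  then show "prim_rec_rel R"
    unfolding prim_rec_rel_def using F(1) by blast
qed

lemma punctual_eqrel_kernel:
  assumes "staircase c"
  shows "punctual_eqrel (kernel c)"
  unfolding punctual_eqrel_def
proof (intro conjI)
  show "equiv UNIV (kernel c)"
    unfolding kernel_def by (intro equivI refl_onI symI transI) auto
  show "prim_rec_rel (kernel c)"
    using assms pr_ary_eq_test[of c c] unfolding staircase_def prim_rec_rel_iff kernel_def by simp
  have ex: "\<exists>x. c x = n" for n
    using assms staircase_attains[OF assms] unfolding staircase_def by blast
  have "inj (\<lambda>n. c -` {n})"
    using ex by (intro injI) (metis (mono_tags) insertI1 singletonD vimage_singleton_eq)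
  moreover have "range (\<lambda>n. c -` {n}) \<subseteq> UNIV // kernel c"
  proof
    fix X assume "X \<in> range (\<lambda>n. c -` {n})"
    then obtain n where "X = c -` {n}" by blast
    moreover obtain x where "c x = n" using ex by blast
    ultimately have "X = kernel c `` {x}" unfolding kernel_def by auto
    then show "X \<in> UNIV // kernel c" by (simp add: quotientI)
  qed
  ultimately show "infinite (UNIV // kernel c)"
    using infinite_iff_countable_subset by blast
qed

text \<open>
  A reduction \<open>f\<close> moves the \<open>c x + 1\<close> kernel classes that meet \<open>{0..x}\<close> to as many classes of the kernel
  of \<open>d\<close>.  These have values at most \<open>d (h x)\<close>, where \<open>h\<close> bounds all of \<open>f 0, \<dots>, f x\<close>,
  so there is room for them only if \<open>c x \<le> d (h x)\<close>.  In the other direction, \<open>d\<close> skips no value below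
  \<open>d (h x)\<close>, so a search up to \<open>h x\<close> finds some \<open>z\<close> with \<open>d z = c x\<close>.
\<close>

lemma kernel_le_iff:
  assumes c: "staircase c" and d: "staircase d"
  shows "kernel c \<le>\<^sub>p\<^sub>r kernel d \<longleftrightarrow> dominated c d"
proof
  assume "kernel c \<le>\<^sub>p\<^sub>r kernel d"
  then obtain f where f: "prim_rec_fun f" and red: "\<And>x y. c x = c y \<longleftrightarrow> d (f x) = d (f y)"
    unfolding pr_le_def kernel_def by blast
  \<comment> \<open>The sum is a convenient primitive recursive bound for \<open>f 0, \<dots>, f x\<close>.\<close>
  define h where "h x = (\<Sum>i<Suc x. f i)" for x
  have "prim_rec_fun h"
    unfolding h_def using prim_rec_fun_comp[OF prim_rec_fun_Suc prim_rec_fun_sum[OF f]] .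
  moreover have "c x \<le> d (h x)" for x
  proof -
    have "\<forall>n\<in>{..c x}. \<exists>z. z \<le> x \<and> c z = n"
      using staircase_attains[OF c] by auto
    then obtain g where g: "\<And>n. n \<le> c x \<Longrightarrow> g n \<le> x" "\<And>n. n \<le> c x \<Longrightarrow> c (g n) = n"
      by (auto dest!: bchoice)
    have "inj_on (\<lambda>n. d (f (g n))) {..c x}"
      using g(2) red by (intro inj_onI) (metis atMost_iff)
    moreover have "(\<lambda>n. d (f (g n))) ` {..c x} \<subseteq> {..d (h x)}"
    proof clarsimp
      fix n assume "n \<le> c x"
      then have "f (g n) \<le> h x"
        unfolding h_def using g(1) by (intro member_le_sum) (auto simp: less_Suc_eq_le)
      then show "d (f (g n)) \<le> d (h x)"
        by (rule staircase_mono[OF d])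
    qed
    ultimately have "card {..c x} \<le> card {..d (h x)}"
      by (rule card_inj_on_le) simp
    then show ?thesis by simp
  qed
  ultimately show "dominated c d"
    unfolding dominated_def by blast
next
  assume "dominated c d"
  then obtain h where h: "prim_rec_fun h" "\<And>x. c x \<le> d (h x)"
    unfolding dominated_def by blast
  define f where "f x = first (\<lambda>z. d z = c x) (h x)" for x
  have "prim_rec_fun f"
    unfolding f_def using c d h(1)
    by (intro prim_rec_fun_first pr_ary_eq_test) (simp_all add: staircase_def)
  moreover have "d (f x) = c x" for x
  proof -
    obtain z where "z \<le> h x" "d z = c x"
      using staircase_attains[OF d h(2)] by blast
    then show ?thesis
      unfolding f_def by (rule first_satisfies)
  qed
  ultimately show "kernel c \<le>\<^sub>p\<^sub>r kernel d"
    unfolding pr_le_def kernel_def by auto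
qed

section \<open>The staircase of a punctual equivalence relation\<close>

definition least_rep :: "nat rel \<Rightarrow> nat \<Rightarrow> nat" where
  "least_rep R x = first (\<lambda>z. (z, x) \<in> R) x"

text \<open>
  For an equivalence relation this is one less than the number of classes that meet \<open>{0..x}\<close>.
  Leaving out the class of 0 makes the count start at 0, so that for every \<open>x\<close> its values up to
  \<open>x\<close> are exactly \<open>0, \<dots>, class_count R x\<close>.
\<close>

definition class_count :: "nat rel \<Rightarrow> nat \<Rightarrow> nat" where
  "class_count R x = (\<Sum>i<x. if least_rep R (Suc i) = Suc i then 1 else 0)"

context
  fixes R :: "nat rel"
  assumes R: "punctual_eqrel R"
begin

lemma least_rep_equiv: "(least_rep R x, x) \<in> R"
proof -
  have "(x, x) \<in> R"
    using R unfolding punctual_eqrel_def equiv_def refl_on_def by blast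
  then show ?thesis
    unfolding least_rep_def using first_satisfies[of x x "\<lambda>z. (z, x) \<in> R"] by simp
qed

lemma least_rep_eq_iff: "least_rep R x = least_rep R y \<longleftrightarrow> (x, y) \<in> R"
proof -
  have eqv: "sym R" "trans R"
    using R unfolding punctual_eqrel_def equiv_def by auto
  show ?thesis
  proof
    assume "least_rep R x = least_rep R y"
    then show "(x, y) \<in> R"
      using least_rep_equiv[of x] least_rep_equiv[of y] eqv by (metis symE transE)
  next
    assume "(x, y) \<in> R"
    then have "(least_rep R x, y) \<in> R" "(least_rep R y, x) \<in> R"
      using least_rep_equiv[of x] least_rep_equiv[of y] eqv by (meson symE transE)+
    then have "least_rep R y \<le> least_rep R x" "least_rep R x \<le> least_rep R y"
      unfolding least_rep_def[of R y] least_rep_def[of R x]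
      using first_le[of "\<lambda>z. (z, y) \<in> R"] first_le[of "\<lambda>z. (z, x) \<in> R"]
      by blast+
    then show "least_rep R x = least_rep R y" by simp
  qed
qed

lemma least_rep_idem: "least_rep R (least_rep R x) = least_rep R x"
  by (simp add: least_rep_eq_iff least_rep_equiv)

lemma prim_rec_fun_least_rep: "prim_rec_fun (least_rep R)"
proof -
  have "prim_rec_fun (\<lambda>x. first (\<lambda>z. (z, x) \<in> R) x)"
    using R unfolding punctual_eqrel_def prim_rec_rel_iff
    by (intro prim_rec_fun_first prim_rec_fun_id) auto
  then show ?thesis
    unfolding least_rep_def .
qed

lemma prim_rec_fun_class_count: "prim_rec_fun (class_count R)"
proof -
  have "pr_ary 1 (\<lambda>xs. if least_rep R (Suc (xs ! 0)) = Suc (xs ! 0) then 1 else 0)"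
    by (intro pr_ary_if_eq pr_ary_comp1[OF prim_rec_fun_least_rep] pr_ary_Suc pr_ary_nth
          pr_ary_const) auto
  then have "prim_rec_fun (\<lambda>i. if least_rep R (Suc i) = Suc i then 1 else 0)"
    unfolding prim_rec_fun_iff .
  then show ?thesis
    unfolding class_count_def by (rule prim_rec_fun_sum)
qed

lemma class_count_mono: "x \<le> y \<Longrightarrow> class_count R x \<le> class_count R y"
  unfolding class_count_def by (intro sum_mono2) auto

text \<open>The count goes up at every positive least representative, so it tells them apart.\<close>

lemma class_count_less:
  assumes "x < y" "least_rep R y = y"
  shows "class_count R x < class_count R y"
proof -
  obtain k where k: "y = Suc k" "x \<le> k"
    using assms(1) by (cases y) auto
  then have "class_count R y = Suc (class_count R k)"
    using assms(2) by (simp add: class_count_def)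
  then show ?thesis
    using class_count_mono[OF k(2)] by simp
qed

lemma class_count_inj:
  assumes "least_rep R x = x" "least_rep R y = y" "class_count R x = class_count R y"
  shows "x = y"
  using class_count_less[of x y] class_count_less[of y x] assms by (metis less_irrefl linorder_neqE_nat)

lemma class_count_least_rep_eq_iff:
  "class_count R (least_rep R x) = class_count R (least_rep R y) \<longleftrightarrow> (x, y) \<in> R"
  using class_count_inj least_rep_idem least_rep_eq_iff by metis

text \<open>
  The count at the least representative identifies the class, so a bound on the count would leave
  only finitely many classes.
\<close>

lemma staircase_class_count: "staircase (class_count R)"
  unfolding staircase_def
proof (intro conjI allI)
  show "\<exists>x. n \<le> class_count R x" for n
  proof (rule ccontr)
    assume "\<nexists>x. n \<le> class_count R x"
    then have fin: "finite (range (\<lambda>x. class_count R (least_rep R x)))"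
      by (intro finite_subset[OF _ finite_lessThan[of n]]) (auto simp: not_le)
    have "UNIV // R \<subseteq>
      (\<lambda>v. {y. v = class_count R (least_rep R y)}) ` range (\<lambda>x. class_count R (least_rep R x))"
      by (auto simp: quotient_def class_count_least_rep_eq_iff Image_def image_image)
    then show False
      using fin R finite_subset unfolding punctual_eqrel_def by blast
  qed
qed (auto simp: prim_rec_fun_class_count class_count_def)

text \<open>
  \<open>R\<close> reduces to the kernel by taking least representatives, which the count separates.
  Conversely \<open>x\<close> is sent to the point where the count first reaches its value at \<open>x\<close>.  Such a
  point is 0 or a place where the count goes up, hence a least representative, and distinct least
  representatives are inequivalent.
\<close>

lemma pr_equiv_kernel_class_count: "R \<equiv>\<^sub>p\<^sub>r kernel (class_count R)"
  unfolding pr_equiv_def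
proof
  show "R \<le>\<^sub>p\<^sub>r kernel (class_count R)"
    unfolding pr_le_def kernel_def
    using prim_rec_fun_least_rep class_count_least_rep_eq_iff by auto
next
  let ?c = "class_count R"
  define f where "f x = first (\<lambda>z. ?c z = ?c x) x" for x
  have "prim_rec_fun f"
    unfolding f_def
    by (intro prim_rec_fun_first pr_ary_eq_test prim_rec_fun_class_count prim_rec_fun_id)
  moreover have "?c x = ?c y \<longleftrightarrow> (f x, f y) \<in> R" for x y
  proof -
    have c_f: "?c (f x) = ?c x" for x
      unfolding f_def using first_satisfies[of x x "\<lambda>z. ?c z = ?c x"] by simp
    have rep: "least_rep R (f x) = f x" for x
    proof (cases "f x")
      case 0
      then show ?thesis by (simp add: least_rep_def)
    next
      case (Suc k)
      then have "?c k \<noteq> ?c (Suc k)"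
        using c_f[of x] first_le[of "\<lambda>z. ?c z = ?c x" k x] unfolding f_def by fastforce
      then show ?thesis
        using Suc by (auto simp: class_count_def split: if_splits)
    qed
    have "(f x, f y) \<in> R \<longleftrightarrow> f x = f y"
      by (metis rep least_rep_eq_iff)
    also have "\<dots> \<longleftrightarrow> ?c x = ?c y"
      using class_count_inj[OF rep rep] c_f by metis
    finally show ?thesis by simp
  qed
  ultimately show "kernel ?c \<le>\<^sub>p\<^sub>r R"
    unfolding pr_le_def kernel_def by auto
qed

end

section \<open>The lattice of degrees\<close>

definition deg :: "(nat \<Rightarrow> nat) \<Rightarrow> nat rel set" where
  "deg c = punctual_equiv `` {kernel c}"

lemma carrier_Peq: "carrier Peq = deg ` {c. staircase c}"
proof (intro equalityI subsetI)
  fix a assume "a \<in> carrier Peq"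
  then obtain R where R: "punctual_eqrel R" and a: "a = punctual_equiv `` {R}"
    unfolding Peq_def by (auto elim: quotientE)
  have "(R, kernel (class_count R)) \<in> punctual_equiv"
    using R pr_equiv_kernel_class_count[OF R] punctual_eqrel_kernel[OF staircase_class_count[OF R]]
    unfolding punctual_equiv_def by simp
  then have "a = deg (class_count R)"
    unfolding a deg_def by (rule equiv_class_eq[OF equiv_punctual_equiv])
  then show "a \<in> deg ` {c. staircase c}"
    using staircase_class_count[OF R] by blast
qed (auto simp: Peq_def deg_def intro!: quotientI punctual_eqrel_kernel)

lemma deg_le_iff:
  assumes "staircase c" "staircase d"
  shows "deg c \<sqsubseteq>\<^bsub>Peq\<^esub> deg d \<longleftrightarrow> dominated c d"
  unfolding deg_def using assms
  by (simp add: Peq_le_iff punctual_eqrel_kernel kernel_le_iff)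

lemma staircase_max:
  assumes c: "staircase c" and d: "staircase d"
  shows "staircase (\<lambda>x. max (c x) (d x))"
proof -
  have "max (c x) (d x) \<le> max (c (Suc x)) (d (Suc x)) \<and>
      max (c (Suc x)) (d (Suc x)) \<le> Suc (max (c x) (d x))" for x
  proof -
    have "c x \<le> c (Suc x)" "c (Suc x) \<le> Suc (c x)" "d x \<le> d (Suc x)" "d (Suc x) \<le> Suc (d x)"
      using c d unfolding staircase_def by blast+
    then show ?thesis by linarith
  qed
  moreover have "\<exists>x. n \<le> max (c x) (d x)" for n
    using c unfolding staircase_def by (metis max.coboundedI1)
  ultimately show ?thesis
    using c d unfolding staircase_def by (simp add: prim_rec_fun_max)
qed

text \<open>
  That \<open>c\<close> and \<open>d\<close> are each unbounded does not make them large at the same places.  Monotonicity does: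
  once both have passed \<open>n\<close>, they stay there.
\<close>

lemma staircase_min:
  assumes c: "staircase c" and d: "staircase d"
  shows "staircase (\<lambda>x. min (c x) (d x))"
proof -
  have "\<exists>x. n \<le> min (c x) (d x)" for n
  proof -
    obtain x y where "n \<le> c x" "n \<le> d y"
      using c d unfolding staircase_def by blast
    then have "n \<le> min (c (max x y)) (d (max x y))"
      using staircase_mono[OF c, of x "max x y"] staircase_mono[OF d, of y "max x y"] by simp
    then show ?thesis ..
  qed
  moreover have "min (c x) (d x) \<le> min (c (Suc x)) (d (Suc x)) \<and>
      min (c (Suc x)) (d (Suc x)) \<le> Suc (min (c x) (d x))" for x
  proof -
    have "c x \<le> c (Suc x)" "c (Suc x) \<le> Suc (c x)" "d x \<le> d (Suc x)" "d (Suc x) \<le> Suc (d x)"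
      using c d unfolding staircase_def by blast+
    then show ?thesis by linarith
  qed
  ultimately show ?thesis
    using c d unfolding staircase_def by (simp add: prim_rec_fun_min)
qed

lemma dominated_pointwise: "(\<And>x. c x \<le> d x) \<Longrightarrow> dominated c d"
  unfolding dominated_def using prim_rec_fun_id by blast

text \<open>As \<open>u\<close> is monotone, the larger one of two bounds serves both inequalities.\<close>

lemma dominated_max:
  assumes u: "staircase u" and "dominated c u" "dominated d u"
  shows "dominated (\<lambda>x. max (c x) (d x)) u"
proof -
  obtain h h' where h: "prim_rec_fun h" "\<And>x. c x \<le> u (h x)"
    and h': "prim_rec_fun h'" "\<And>x. d x \<le> u (h' x)"
    using assms(2,3) unfolding dominated_def by blast
  have "max (c x) (d x) \<le> u (max (h x) (h' x))" for x
    using h(2)[of x] h'(2)[of x] staircase_mono[OF u, of "h x" "max (h x) (h' x)"]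
      staircase_mono[OF u, of "h' x" "max (h x) (h' x)"] by simp
  then show ?thesis
    unfolding dominated_def using prim_rec_fun_max[OF h(1) h'(1)] by blast
qed

lemma dominated_min:
  assumes c: "staircase c" and d: "staircase d" and "dominated u c" "dominated u d"
  shows "dominated u (\<lambda>x. min (c x) (d x))"
proof -
  obtain h h' where h: "prim_rec_fun h" "\<And>x. u x \<le> c (h x)"
    and h': "prim_rec_fun h'" "\<And>x. u x \<le> d (h' x)"
    using assms(3,4) unfolding dominated_def by blast
  have "u x \<le> min (c (max (h x) (h' x))) (d (max (h x) (h' x)))" for x
    using h(2)[of x] h'(2)[of x] staircase_mono[OF c, of "h x" "max (h x) (h' x)"]
      staircase_mono[OF d, of "h' x" "max (h x) (h' x)"] by simp
  then show ?thesis
    unfolding dominated_def using prim_rec_fun_max[OF h(1) h'(1)] by blast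
qed

lemma partial_order_Peq: "partial_order Peq"
proof
  have carrier_cases: "\<exists>R. punctual_eqrel R \<and> a = punctual_equiv `` {R}" if "a \<in> carrier Peq" for a
    using that unfolding Peq_def by (auto elim: quotientE)
  show "a \<sqsubseteq>\<^bsub>Peq\<^esub> a" if "a \<in> carrier Peq" for a
    using carrier_cases[OF that] Peq_le_iff pr_le_refl by blast
  show "a .=\<^bsub>Peq\<^esub> b"
    if le: "a \<sqsubseteq>\<^bsub>Peq\<^esub> b" "b \<sqsubseteq>\<^bsub>Peq\<^esub> a" and carr: "a \<in> carrier Peq" "b \<in> carrier Peq" for a b
  proof -
    obtain R S where RS: "punctual_eqrel R" "punctual_eqrel S"
      and ab: "a = punctual_equiv `` {R}" "b = punctual_equiv `` {S}"
      using carr[THEN carrier_cases] by blast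
    then have "(R, S) \<in> punctual_equiv"
      using le Peq_le_iff unfolding punctual_equiv_def pr_equiv_def by blast
    then show ?thesis
      unfolding ab by (simp add: Peq_def equiv_class_eq[OF equiv_punctual_equiv])
  qed
  show "a \<sqsubseteq>\<^bsub>Peq\<^esub> d"
    if le: "a \<sqsubseteq>\<^bsub>Peq\<^esub> b" "b \<sqsubseteq>\<^bsub>Peq\<^esub> d" and carr: "a \<in> carrier Peq" "b \<in> carrier Peq" "d \<in> carrier Peq"
    for a b d
  proof -
    obtain R S T where "punctual_eqrel R" "punctual_eqrel S" "punctual_eqrel T"
      "a = punctual_equiv `` {R}" "b = punctual_equiv `` {S}" "d = punctual_equiv `` {T}"
      using carr[THEN carrier_cases] by blast
    then show ?thesis
      using le by (simp add: Peq_le_iff) (rule pr_le_trans)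
  qed
qed (auto simp: Peq_def)

lemma least_deg_max:
  assumes c: "staircase c" and d: "staircase d"
  shows "least Peq (deg (\<lambda>x. max (c x) (d x))) (Upper Peq {deg c, deg d})"
proof (rule least_UpperI)
  note m = staircase_max[OF c d]
  fix a assume "a \<in> Upper Peq {deg c, deg d}"
  then have "a \<in> carrier Peq" and le: "deg c \<sqsubseteq>\<^bsub>Peq\<^esub> a" "deg d \<sqsubseteq>\<^bsub>Peq\<^esub> a"
    using c d unfolding Upper_def by (auto simp: carrier_Peq)
  then obtain u where u: "staircase u" "a = deg u"
    unfolding carrier_Peq by blast
  show "deg (\<lambda>x. max (c x) (d x)) \<sqsubseteq>\<^bsub>Peq\<^esub> a"
    using le dominated_max[OF u(1)] unfolding u(2)
    by (simp add: deg_le_iff c d m u(1))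
qed (use c d staircase_max[OF c d] in
      \<open>auto simp: carrier_Peq deg_le_iff intro!: dominated_pointwise\<close>)

lemma greatest_deg_min:
  assumes c: "staircase c" and d: "staircase d"
  shows "greatest Peq (deg (\<lambda>x. min (c x) (d x))) (Lower Peq {deg c, deg d})"
proof (rule greatest_LowerI)
  note m = staircase_min[OF c d]
  fix a assume "a \<in> Lower Peq {deg c, deg d}"
  then have "a \<in> carrier Peq" and le: "a \<sqsubseteq>\<^bsub>Peq\<^esub> deg c" "a \<sqsubseteq>\<^bsub>Peq\<^esub> deg d"
    using c d unfolding Lower_def by (auto simp: carrier_Peq)
  then obtain u where u: "staircase u" "a = deg u"
    unfolding carrier_Peq by blast
  show "a \<sqsubseteq>\<^bsub>Peq\<^esub> deg (\<lambda>x. min (c x) (d x))"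
    using le dominated_min[OF c d] unfolding u(2)
    by (simp add: deg_le_iff c d m u(1))
qed (use c d staircase_min[OF c d] in
      \<open>auto simp: carrier_Peq deg_le_iff intro!: dominated_pointwise\<close>)

lemma lattice_Peq: "lattice Peq"
proof -
  interpret partial_order Peq
    by (rule partial_order_Peq)
  show ?thesis
  proof
    show "\<exists>s. least Peq s (Upper Peq {a, b})" if "a \<in> carrier Peq" "b \<in> carrier Peq" for a b
      using that least_deg_max unfolding carrier_Peq by blast
    show "\<exists>s. greatest Peq s (Lower Peq {a, b})" if "a \<in> carrier Peq" "b \<in> carrier Peq" for a b
      using that greatest_deg_min unfolding carrier_Peq by blast
  qed
qed

theorem theorem5p8:
  shows "distributive_lattice Peq"
proof -
  interpret lattice Peq
    by (rule lattice_Peq)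
  have join: "deg c \<squnion>\<^bsub>Peq\<^esub> deg d = deg (\<lambda>x. max (c x) (d x))"
    if "staircase c" "staircase d" for c d
    by (rule joinI) (erule least_unique[OF _ least_deg_max[OF that]], simp_all add: carrier_Peq that)
  have meet: "deg c \<sqinter>\<^bsub>Peq\<^esub> deg d = deg (\<lambda>x. min (c x) (d x))"
    if "staircase c" "staircase d" for c d
    by (rule meetI) (erule greatest_unique[OF _ greatest_deg_min[OF that]], simp_all add: carrier_Peq that)
  show ?thesis
  proof
    fix x y z assume "x \<in> carrier Peq" "y \<in> carrier Peq" "z \<in> carrier Peq"
    then obtain c d e where "staircase c" "staircase d" "staircase e"
      and "x = deg c" "y = deg d" "z = deg e"
      unfolding carrier_Peq by blast
    then show "x \<sqinter>\<^bsub>Peq\<^esub> (y \<squnion>\<^bsub>Peq\<^esub> z) = (x \<sqinter>\<^bsub>Peq\<^esub> y) \<squnion>\<^bsub>Peq\<^esub> (x \<sqinter>\<^bsub>Peq\<^esub> z)"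
      by (simp add: join meet staircase_max staircase_min min_max_distrib2)
  qed
qed

end
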